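(* Let $\mathfrak g$ be an $8$-dimensional real nilpotent Lie algebra with a 1-abelian complex structure $J_M$ of maximal type defined by a singular non-Hermitian matrix $M\in M_3(\mathbb C)$. Then $\mathfrak g$ is isomorphic to one in the following list, where in all cases $\{e^1,\dots,e^8\}$ is a basis of $1$-forms with $de^j=0$ for $j=1,\dots,6$: (i) $\mathfrak g^8_{s1}$: $de^7=e^{13}+e^{24}$, $de^8=e^{36}+e^{45}$; (ii) $\mathfrak g^8_{r5}$: $de^7=e^{13}+e^{24}+e^{56}$, $de^8=e^{14}-e^{23}$.
   Context: $e^{jk}=e^j\wedge e^k$, and $d$ is the Chevalley–Eilenberg differential (so the structure equations determine the Lie algebra). For a complex structure $J$ on a real Lie algebra $\mathfrak g$, $\mathfrak g^{1,0}\subset\mathfrak g^*_{\mathbb C}$ is the space of $(1,0)$-forms. $J$ is abelian if $[Jx,Jy]=[x,y]$ for all $x,y$. An abelian complex structure on a $2n$-dimensional nilpotent Lie algebra is 1-abelian if $h^{1,0}=\dim\ker(\bar\partial:\mathfrak g^{1,0}\to\bigwedge^{1,1}\mathfrak g^* )$ equals $n-1$. For every 1-abelian complex structure there are a basis $\{\omega^i\}_{i=1}^n$ of $\mathfrak g^{1,0}$ and a nonzero $M\in M_{n-1}(\mathbb C)$ with $d\omega^1=\dots=d\omega^{n-1}=0$ and $d\omega^n=\sum_{j,k=1}^{n-1}M_{jk}\,\omega^{j}\wedge\overline{\omega^{k}}$; the structure is then denoted $J_M$. Maximal type. Let $M$ be a singular $k\times k$ complex matrix and $m_1=k-\mathrm{rank}(M)$.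 Choose an invertible $S$ such that the last $m_1$ rows of $SM$ vanish, and write $SMS^*=\begin{pmatrix}M'&N\\0&0_{m_1}\end{pmatrix}$ with $M'$ of size $k-m_1$ ($S^*$ is the conjugate transpose); put $m_2=\mathrm{rank}(N)$ (independent of $S$). $J_M$ (or $M$) is of maximal type if $m_1=m_2$. *)

theory Defs
  imports
    "HOL-Analysis.Analysis"
    "HOL-Library.Function_Algebras"
    "Jordan_Normal_Form.DL_Rank"
    "Jordan_Normal_Form.Schur_Decomposition"
begin

text \<open>The underlying vector space of a Lie algebra is a type of class \<open>real_vector\<close>; the bracket
  is an explicit parameter.\<close>

definition lie_algebra :: "('a::real_vector \<Rightarrow> 'a \<Rightarrow> 'a) \<Rightarrow> bool" where
  "lie_algebra br \<longleftrightarrow>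
     (\<forall>x. linear (br x)) \<and> (\<forall>y. linear (\<lambda>x. br x y)) \<and>
     (\<forall>x. br x x = 0) \<and>
     (\<forall>x y z. br x (br y z) + br y (br z x) + br z (br x y) = 0)"

fun lower_central :: "('a::real_vector \<Rightarrow> 'a \<Rightarrow> 'a) \<Rightarrow> nat \<Rightarrow> 'a set" where
  "lower_central br 0 = UNIV"
| "lower_central br (Suc k) = span {br x y | x y. y \<in> lower_central br k}"

definition nilpotent_lie :: "('a::real_vector \<Rightarrow> 'a \<Rightarrow> 'a) \<Rightarrow> bool" where
  "nilpotent_lie br \<longleftrightarrow> (\<exists>k. lower_central br k = {0})"

definition lie_isomorphic ::
    "('a::real_vector \<Rightarrow> 'a \<Rightarrow> 'a) \<Rightarrow> ('b::real_vector \<Rightarrow> 'b \<Rightarrow> 'b) \<Rightarrow> bool" where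
  "lie_isomorphic br br' \<longleftrightarrow>
     (\<exists>f. linear f \<and> bij f \<and> (\<forall>x y. f (br x y) = br' (f x) (f y)))"

text \<open>Forms with real or complex values are functions on the real Lie algebra, so an element of
  the complexified dual is a real-linear map into \<open>complex\<close>.\<close>

definition ce_d :: "('a \<Rightarrow> 'a \<Rightarrow> 'a) \<Rightarrow> ('a \<Rightarrow> 'b::group_add) \<Rightarrow> 'a \<Rightarrow> 'a \<Rightarrow> 'b" where
  "ce_d br \<alpha> = (\<lambda>x y. - \<alpha> (br x y))"

definition wedge :: "('a \<Rightarrow> 'b::comm_ring) \<Rightarrow> ('a \<Rightarrow> 'b) \<Rightarrow> 'a \<Rightarrow> 'a \<Rightarrow> 'b" where
  "wedge \<alpha> \<beta> = (\<lambda>x y. \<alpha> x * \<beta> y - \<alpha> y * \<beta> x)"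

definition cnj_form :: "('a \<Rightarrow> complex) \<Rightarrow> 'a \<Rightarrow> complex" where
  "cnj_form \<alpha> = (\<lambda>x. cnj (\<alpha> x))"

global_interpretation cform: vector_space "\<lambda>(c::complex) (\<alpha>::'a \<Rightarrow> complex). (\<lambda>x. c * \<alpha> x)"
  by unfold_locales (auto simp: fun_eq_iff algebra_simps)

definition complex_structure ::
    "('a::real_vector \<Rightarrow> 'a \<Rightarrow> 'a) \<Rightarrow> ('a \<Rightarrow> 'a) \<Rightarrow> bool" where
  "complex_structure br J \<longleftrightarrow>
     linear J \<and> (\<forall>x. J (J x) = - x) \<and>
     (\<forall>x y. br (J x) (J y) - J (br (J x) y) - J (br x (J y)) - br x y = 0)"

definition abelian_complex_structure ::
    "('a::real_vector \<Rightarrow> 'a \<Rightarrow> 'a) \<Rightarrow> ('a \<Rightarrow> 'a) \<Rightarrow> bool" where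
  "abelian_complex_structure br J \<longleftrightarrow>
     complex_structure br J \<and> (\<forall>x y. br (J x) (J y) = br x y)"

definition forms10 :: "('a::real_vector \<Rightarrow> 'a) \<Rightarrow> ('a \<Rightarrow> complex) set" where
  "forms10 J = {\<alpha>. linear \<alpha> \<and> (\<forall>x. \<alpha> (J x) = \<i> * \<alpha> x)}"

text \<open>The (1,1)-component of a complex 2-form: pulling back along \<open>J\<close> acts as \<open>1\<close> on forms of
  type (1,1) and as \<open>-1\<close> on those of type (2,0) and (0,2), as checked by the three lemmas below.\<close>

definition part11 :: "('a \<Rightarrow> 'a) \<Rightarrow> ('a \<Rightarrow> 'a \<Rightarrow> complex) \<Rightarrow> 'a \<Rightarrow> 'a \<Rightarrow> complex" where
  "part11 J \<beta> = (\<lambda>x y. (\<beta> x y + \<beta> (J x) (J y)) / 2)"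

lemma part11_of_type_1_1:
  assumes "\<alpha> \<in> forms10 J" "\<beta> \<in> forms10 J"
  shows "part11 J (wedge \<alpha> (cnj_form \<beta>)) = wedge \<alpha> (cnj_form \<beta>)"
  using assms
  by (simp add: part11_def wedge_def cnj_form_def forms10_def fun_eq_iff field_simps)

lemma part11_of_type_2_0:
  assumes "\<alpha> \<in> forms10 J" "\<beta> \<in> forms10 J"
  shows "part11 J (wedge \<alpha> \<beta>) = (\<lambda>x y. 0)"
  using assms by (simp add: part11_def wedge_def forms10_def fun_eq_iff algebra_simps)

lemma part11_of_type_0_2:
  assumes "\<alpha> \<in> forms10 J" "\<beta> \<in> forms10 J"
  shows "part11 J (wedge (cnj_form \<alpha>) (cnj_form \<beta>)) = (\<lambda>x y. 0)"
  using assms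
  by (simp add: part11_def wedge_def cnj_form_def forms10_def fun_eq_iff algebra_simps)

definition dbar ::
    "('a \<Rightarrow> 'a \<Rightarrow> 'a) \<Rightarrow> ('a \<Rightarrow> 'a) \<Rightarrow> ('a \<Rightarrow> complex) \<Rightarrow> 'a \<Rightarrow> 'a \<Rightarrow> complex" where
  "dbar br J \<alpha> = part11 J (ce_d br \<alpha>)"

definition h10 :: "('a::real_vector \<Rightarrow> 'a \<Rightarrow> 'a) \<Rightarrow> ('a \<Rightarrow> 'a) \<Rightarrow> nat" where
  "h10 br J = cform.dim {\<alpha> \<in> forms10 J. dbar br J \<alpha> = (\<lambda>x y. 0)}"

definition one_abelian ::
    "('a::real_vector \<Rightarrow> 'a \<Rightarrow> 'a) \<Rightarrow> ('a \<Rightarrow> 'a) \<Rightarrow> nat \<Rightarrow> bool" where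
  "one_abelian br J n \<longleftrightarrow>
     lie_algebra br \<and> nilpotent_lie br \<and> dim (UNIV :: 'a set) = 2 * n \<and>
     abelian_complex_structure br J \<and> h10 br J + 1 = n"

text \<open>\<open>J\<close> is \<open>J_M\<close> with respect to the basis \<open>\<omega> 0, \<dots>, \<omega> (n - 1)\<close>. Indices of forms and of matrix
  entries start at \<open>0\<close>, so the non-closed form is \<open>\<omega> (n - 1)\<close>.\<close>

definition defined_by_matrix ::
    "('a::real_vector \<Rightarrow> 'a \<Rightarrow> 'a) \<Rightarrow> ('a \<Rightarrow> 'a) \<Rightarrow> nat \<Rightarrow> (nat \<Rightarrow> 'a \<Rightarrow> complex) \<Rightarrow> complex mat \<Rightarrow> bool"
  where
  "defined_by_matrix br J n \<omega> M \<longleftrightarrow>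
     inj_on \<omega> {..<n} \<and> cform.independent (\<omega> ` {..<n}) \<and>
     cform.span (\<omega> ` {..<n}) = forms10 J \<and>
     M \<in> carrier_mat (n - 1) (n - 1) \<and> M \<noteq> 0\<^sub>m (n - 1) (n - 1) \<and>
     (\<forall>i<n - 1. ce_d br (\<omega> i) = (\<lambda>x y. 0)) \<and>
     ce_d br (\<omega> (n - 1)) =
       (\<lambda>x y. \<Sum>j<n - 1. \<Sum>k<n - 1. M $$ (j, k) * wedge (\<omega> j) (cnj_form (\<omega> k)) x y)"

text \<open>\<open>m\<^sub>2 = rank N\<close> does not depend on the choice of \<open>S\<close>, hence the existential quantifier.\<close>

definition maximal_type :: "complex mat \<Rightarrow> bool" where
  "maximal_type M \<longleftrightarrow>
     (let k = dim_row M; m1 = k - vec_space.rank k M in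
      \<exists>S M' N. S \<in> carrier_mat k k \<and> invertible_mat S \<and>
        (\<forall>i\<in>{k - m1..<k}. row (S * M) i = 0\<^sub>v k) \<and>
        M' \<in> carrier_mat (k - m1) (k - m1) \<and> N \<in> carrier_mat (k - m1) m1 \<and>
        S * M * mat_adjoint S =
          four_block_mat M' N (0\<^sub>m m1 (k - m1)) (0\<^sub>m m1 m1) \<and>
        m1 = vec_space.rank (k - m1) N)"

text \<open>The basis of coordinate forms on \<open>real^8\<close>. The index type satisfies \<open>8 = 0\<close>, so
  \<open>1, \<dots>, 8\<close> are its eight elements. Since \<open>(d\<alpha>)(x,y) = -\<alpha>([x,y])\<close>, the last two coordinates of
  the bracket are the negatives of the prescribed differentials.\<close>

definition coform :: "8 \<Rightarrow> real^8 \<Rightarrow> real" where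
  "coform i = (\<lambda>x. vec_nth x i)"

definition g8_s1 :: "real^8 \<Rightarrow> real^8 \<Rightarrow> real^8" where
  "g8_s1 x y = (\<chi> i.
     if i = 7 then - (wedge (coform 1) (coform 3) x y + wedge (coform 2) (coform 4) x y)
     else if i = 8 then - (wedge (coform 3) (coform 6) x y + wedge (coform 4) (coform 5) x y)
     else 0)"

definition g8_r5 :: "real^8 \<Rightarrow> real^8 \<Rightarrow> real^8" where
  "g8_r5 x y = (\<chi> i.
     if i = 7 then - (wedge (coform 1) (coform 3) x y + wedge (coform 2) (coform 4) x y + wedge (coform 5) (coform 6) x y)
     else if i = 8 then - (wedge (coform 1) (coform 4) x y - wedge (coform 2) (coform 3) x y)
     else 0)"

lemma g8_s1_structure:
  "i \<in> {1, 2, 3, 4, 5, 6} \<Longrightarrow> ce_d g8_s1 (coform i) = 0"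
  "ce_d g8_s1 (coform 7) = wedge (coform 1) (coform 3) + wedge (coform 2) (coform 4)"
  "ce_d g8_s1 (coform 8) = wedge (coform 3) (coform 6) + wedge (coform 4) (coform 5)"
  by (auto simp: ce_d_def g8_s1_def coform_def fun_eq_iff)

lemma g8_r5_structure:
  "i \<in> {1, 2, 3, 4, 5, 6} \<Longrightarrow> ce_d g8_r5 (coform i) = 0"
  "ce_d g8_r5 (coform 7) = wedge (coform 1) (coform 3) + wedge (coform 2) (coform 4) + wedge (coform 5) (coform 6)"
  "ce_d g8_r5 (coform 8) = wedge (coform 1) (coform 4) - wedge (coform 2) (coform 3)"
  by (auto simp: ce_d_def g8_r5_def coform_def fun_eq_iff)

lemma lie_algebra_g8_s1: "lie_algebra g8_s1"
proof -
  have c: "coform i (g8_s1 x y) = 0" if "i \<notin> {7, 8}" for i x y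
    using that by (simp add: coform_def g8_s1_def)
  have "g8_s1 x (g8_s1 y z) = 0" for x y z
    by (simp add: g8_s1_def[of x] wedge_def c Finite_Cartesian_Product.vec_eq_iff)
  moreover have "linear (g8_s1 x)" "linear (\<lambda>x. g8_s1 x y)" "g8_s1 x x = 0" for x y
    by (auto intro!: linearI simp: g8_s1_def wedge_def coform_def Finite_Cartesian_Product.vec_eq_iff algebra_simps)
  ultimately show ?thesis
    by (simp add: lie_algebra_def)
qed

lemma lie_algebra_g8_r5: "lie_algebra g8_r5"
proof -
  have c: "coform i (g8_r5 x y) = 0" if "i \<notin> {7, 8}" for i x y
    using that by (simp add: coform_def g8_r5_def)
  have "g8_r5 x (g8_r5 y z) = 0" for x y z
    by (simp add: g8_r5_def[of x] wedge_def c Finite_Cartesian_Product.vec_eq_iff)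
  moreover have "linear (g8_r5 x)" "linear (\<lambda>x. g8_r5 x y)" "g8_r5 x x = 0" for x y
    by (auto intro!: linearI simp: g8_r5_def wedge_def coform_def Finite_Cartesian_Product.vec_eq_iff algebra_simps)
  ultimately show ?thesis
    by (simp add: lie_algebra_def)
qed

end

theory Submission
  imports Defs
begin

text \<open>
  A singular \<open>M\<close> of size \<open>3\<close> can only be of maximal type if \<open>m\<^sub>1 = 1\<close>, because \<open>N\<close> has
  \<open>3 - m\<^sub>1\<close> rows and rank \<open>m\<^sub>1\<close>. So \<open>M\<close> has rank \<open>2\<close>, and for some invertible \<open>S\<close> the matrix
  \<open>A = S M S\<^sup>*\<close> has vanishing last row and a nonzero entry in the last column. In the closed
  coframe \<open>\<eta>\<close> with \<open>\<omega> = S\<^sup>T \<eta>\<close>, the differential of the last form \<open>\<tau>\<close> becomes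
  \<open>d\<tau> = \<alpha> \<and> \<rho>\<^sup>* + \<beta> \<and> \<sigma>\<^sup>*\<close>, where \<open>\<alpha>\<close>, \<open>\<beta>\<close> are the first two forms, the star is conjugation,
  and \<open>\<rho>\<close>, \<open>\<sigma>\<close> are the forms with the conjugated rows of \<open>A\<close> as coefficients. They are linearly
  independent since \<open>A\<close> has rank \<open>2\<close>, and (after exchanging the rows if necessary) \<open>\<sigma>\<close> has a
  component along the third form \<open>\<gamma>\<close> (\<open>maximal_type_singular_3\<close>), so that \<open>\<alpha>\<close>, \<open>\<beta>\<close>, \<open>\<sigma>\<close> is again a coframe.

  Subtracting a multiple of \<open>\<sigma>\<close> from \<open>\<rho>\<close>, which amounts to adding a multiple of \<open>\<alpha>\<close> to \<open>\<beta>\<close>,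
  makes \<open>\<rho> = P \<alpha> + Q \<beta>\<close> with \<open>(P, Q) \<noteq> 0\<close>. Whether \<open>P\<close> vanishes decides between two normal forms:
  for \<open>P = 0\<close> rescaling gives \<open>d\<tau> = \<alpha> \<and> \<beta>\<^sup>* + \<beta> \<and> \<gamma>\<^sup>*\<close>, where \<open>M\<close> is a nilpotent Jordan block;
  for \<open>P \<noteq> 0\<close> completing the square in \<open>\<alpha>\<close> gives \<open>d\<tau> = \<alpha> \<and> \<alpha>\<^sup>* + \<beta> \<and> \<gamma>\<^sup>*\<close>
  (lemma \<open>isomorphic_of_rank_two_differential\<close>). The real and imaginary parts of these two equations are the
  structure equations of \<open>g8_s1\<close> (\<open>isomorphic_g8_s1\<close>) and of \<open>g8_r5\<close> (\<open>isomorphic_g8_r5\<close>).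
\<close>

section \<open>Congruence and rank of complex matrices\<close>

lemma mat_adjoint_carrier: "A \<in> carrier_mat m n \<Longrightarrow> mat_adjoint A \<in> carrier_mat n m"
  unfolding mat_adjoint_def by (metis carrier_matD cols_length length_map mat_of_rows_carrier(1))

lemma mat_adjoint_index:
  assumes A: "A \<in> carrier_mat m n" and i: "i < n" and j: "j < m"
  shows "mat_adjoint A $$ (i, j) = conjugate (A $$ (j, i))"
proof -
  have dims: "dim_row A = m" "dim_col A = n"
    using A by (rule carrier_matD)+
  have "mat_adjoint A $$ (i, j) = map conjugate (cols A) ! i $ j"
    unfolding mat_adjoint_def using i j dims by (intro mat_of_rows_index) simp_all
  also have "\<dots> = conjugate (col A i) $ j"
    using i dims by simp
  also have "\<dots> = conjugate (A $$ (j, i))"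
    using i j dims by simp
  finally show ?thesis .
qed

lemma mat_adjoint_mult:
  fixes A B :: "complex mat"
  assumes A: "A \<in> carrier_mat l m" and B: "B \<in> carrier_mat m n"
  shows "mat_adjoint (A * B) = mat_adjoint B * mat_adjoint A"
proof (rule eq_matI)
  note c = mat_adjoint_carrier[OF A] mat_adjoint_carrier[OF B]
    mat_adjoint_carrier[OF mult_carrier_mat[OF A B]]
  fix i j
  assume "i < dim_row (mat_adjoint B * mat_adjoint A)" "j < dim_col (mat_adjoint B * mat_adjoint A)"
  then have "i < n" "j < l"
    using c by auto
  then show "mat_adjoint (A * B) $$ (i, j) = (mat_adjoint B * mat_adjoint A) $$ (i, j)"
    using A B c
    by (simp add: mat_adjoint_index[OF mult_carrier_mat[OF A B]] mat_adjoint_index[OF A]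
        mat_adjoint_index[OF B] scalar_prod_def mult.commute)
qed (use mat_adjoint_carrier[OF A] mat_adjoint_carrier[OF B]
       mat_adjoint_carrier[OF mult_carrier_mat[OF A B]] in auto)

lemma mat_adjoint_one: "mat_adjoint (1\<^sub>m n :: complex mat) = 1\<^sub>m n"
proof (rule eq_matI)
  fix i j assume "i < dim_row (1\<^sub>m n :: complex mat)" "j < dim_col (1\<^sub>m n :: complex mat)"
  then show "mat_adjoint (1\<^sub>m n :: complex mat) $$ (i, j) = 1\<^sub>m n $$ (i, j)"
    by (simp add: mat_adjoint_index[OF one_carrier_mat])
qed (use mat_adjoint_carrier[OF one_carrier_mat] in auto)

lemma mult_mat_index_sum:
  assumes "A \<in> carrier_mat m n" "B \<in> carrier_mat n p" "i < m" "j < p"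
  shows "(A * B) $$ (i, j) = (\<Sum>k<n. A $$ (i, k) * B $$ (k, j))"
  using assms by (simp add: scalar_prod_def lessThan_atLeast0)

text \<open>The product of an outer product \<open>f g\<^sup>T\<close> with matrices on both sides is the outer product
  of \<open>P f\<close> and \<open>Q\<^sup>T g\<close>. With invertible \<open>P\<close> and \<open>Q\<close> this carries a rank bound back through a
  congruence.\<close>

lemma rank_le_1_mult_product_entries:
  fixes f g :: "nat \<Rightarrow> complex"
  assumes P: "P \<in> carrier_mat m k" and A: "A \<in> carrier_mat k l" and Q: "Q \<in> carrier_mat l n"
    and fg: "\<And>r c. r < k \<Longrightarrow> c < l \<Longrightarrow> A $$ (r, c) = f r * g c"
  shows "vec_space.rank m (P * A * Q) \<le> 1"
proof (rule vec_space.rank_le_1_product_entries)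
  show PAQ: "P * A * Q \<in> carrier_mat m n"
    using P A Q by auto
  fix r c assume "r < dim_row (P * A * Q)" "c < dim_col (P * A * Q)"
  then have r: "r < m" and c: "c < n"
    using PAQ by auto
  have "(P * A) $$ (r, j) = (\<Sum>i<k. P $$ (r, i) * f i) * g j" if "j < l" for j
    unfolding mult_mat_index_sum[OF P A r that] sum_distrib_right
    using fg that by (intro sum.cong) auto
  then show "(P * A * Q) $$ (r, c) =
      (\<Sum>i<k. P $$ (r, i) * f i) * (\<Sum>j<l. g j * Q $$ (j, c))"
    unfolding mult_mat_index_sum[OF mult_carrier_mat[OF P A] Q r c] sum_distrib_left
    by (intro sum.cong) auto
qed

text \<open>In size \<open>3\<close> the condition \<open>rank N = m\<^sub>1\<close> excludes \<open>m\<^sub>1 = 2\<close> and \<open>m\<^sub>1 = 3\<close>, where \<open>N\<close> has at most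
  one row, and singularity excludes \<open>m\<^sub>1 = 0\<close>. For \<open>m\<^sub>1 = 1\<close>, the column \<open>N\<close> has rank \<open>1\<close> exactly when it is
  nonzero.\<close>

lemma maximal_type_singular_3:
  fixes M :: "complex mat"
  assumes M: "M \<in> carrier_mat 3 3" and sing: "\<not> invertible_mat M" and max: "maximal_type M"
  obtains S P where "S \<in> carrier_mat 3 3" "P \<in> carrier_mat 3 3" "S * P = 1\<^sub>m 3" "P * S = 1\<^sub>m 3"
    "vec_space.rank 3 M = 2"
    "\<And>c. c < 3 \<Longrightarrow> (S * M * mat_adjoint S) $$ (2, c) = 0"
    "(S * M * mat_adjoint S) $$ (0, 2) \<noteq> 0 \<or> (S * M * mat_adjoint S) $$ (1, 2) \<noteq> 0"
proof -
  define r where "r = vec_space.rank 3 M"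
  define m1 where "m1 = 3 - r"
  obtain S M' N where S: "S \<in> carrier_mat 3 3" "invertible_mat S"
    and M': "M' \<in> carrier_mat (3 - m1) (3 - m1)" and N: "N \<in> carrier_mat (3 - m1) m1"
    and blk: "S * M * mat_adjoint S = four_block_mat M' N (0\<^sub>m m1 (3 - m1)) (0\<^sub>m m1 m1)"
    and rk: "m1 = vec_space.rank (3 - m1) N"
    using max M by (auto simp: maximal_type_def Let_def m1_def r_def)
  obtain P where P: "P \<in> carrier_mat 3 3" "S * P = 1\<^sub>m 3" "P * S = 1\<^sub>m 3"
  proof -
    obtain B where "S * B = 1\<^sub>m (dim_row S)" "B * S = 1\<^sub>m (dim_row B)"
      using S(2) by (auto simp: invertible_mat_def inverts_mat_def)
    moreover from this have "B \<in> carrier_mat 3 3"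
      using S(1) by (metis carrier_matD carrier_matI index_mult_mat(2,3) index_one_mat(2,3))
    ultimately show thesis
      using that S(1) by auto
  qed
  have "r \<le> 3"
    using vec_space.rank_le_nc[OF M] by (simp add: r_def)
  have "det M = 0"
  proof (rule ccontr)
    assume "det M \<noteq> 0"
    then obtain B where "B \<in> carrier_mat 3 3" "B * M = 1\<^sub>m 3" "M * B = 1\<^sub>m 3"
      using det_non_zero_imp_unit[OF M] by (auto simp: Units_def ring_mat_def)
    then show False
      using sing M by (auto simp: invertible_mat_def inverts_mat_def)
  qed
  then have "r < 3"
    using vec_space.det_zero_low_rank[OF M] by (simp add: r_def)
  have "m1 \<le> 1"
  proof (rule ccontr)
    assume "\<not> m1 \<le> 1"
    then have r0: "r < 3 - m1 \<Longrightarrow> r = 0" for r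
      by linarith
    have "vec_space.rank (3 - m1) N \<le> 1"
      using N by (intro vec_space.rank_le_1_product_entries[OF N, of "\<lambda>_. 1" "\<lambda>c. N $$ (0, c)"])
        (auto dest: r0)
    then show False
      using rk \<open>\<not> m1 \<le> 1\<close> by simp
  qed
  then have m1: "m1 = 1" and r: "r = 2"
    using \<open>r < 3\<close> by (auto simp: m1_def)
  have N: "N \<in> carrier_mat 2 1" and M': "M' \<in> carrier_mat 2 2"
    using N M' m1 by auto
  have "N \<noteq> 0\<^sub>m 2 1"
    using rk m1 vec_space.rank_0I[where n = 2 and nc = 1 and 'a = complex] by auto
  then have "N $$ (0, 0) \<noteq> 0 \<or> N $$ (1, 0) \<noteq> 0"
    using N by (auto simp: Matrix.mat_eq_iff less_Suc_eq numeral_2_eq_2)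
  moreover have "(S * M * mat_adjoint S) $$ (i, 2) = N $$ (i, 0)" if "i < 2" for i
    unfolding blk using that M' N m1 by (subst index_mat_four_block) auto
  ultimately have nz: "(S * M * mat_adjoint S) $$ (0, 2) \<noteq> 0 \<or> (S * M * mat_adjoint S) $$ (1, 2) \<noteq> 0"
    by auto
  have zr: "(S * M * mat_adjoint S) $$ (2, c) = 0" if "c < 3" for c
    unfolding blk using that M' N m1 by (subst index_mat_four_block) auto
  show thesis
    using that[OF S(1) P] zr nz r r_def by auto
qed

text \<open>Two independent families \<open>a\<close> and \<open>b\<close> are needed because a wedge product evaluates the forms
  at two different vectors.\<close>

lemma sesquilinear_base_change:
  fixes a b a' b' :: "nat \<Rightarrow> complex"
  assumes S: "S \<in> carrier_mat n n" and M: "M \<in> carrier_mat n n"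
    and a: "\<And>j. j < n \<Longrightarrow> a j = (\<Sum>l<n. S $$ (l, j) * a' l)"
    and b: "\<And>k. k < n \<Longrightarrow> b k = (\<Sum>m<n. S $$ (m, k) * b' m)"
  shows "(\<Sum>j<n. \<Sum>k<n. M $$ (j, k) * (a j * cnj (b k))) =
    (\<Sum>l<n. \<Sum>m<n. (S * M * mat_adjoint S) $$ (l, m) * (a' l * cnj (b' m)))"
proof -
  have entry: "(S * M * mat_adjoint S) $$ (l, m) =
      (\<Sum>k<n. \<Sum>j<n. S $$ (l, j) * M $$ (j, k) * cnj (S $$ (m, k)))" if "l < n" "m < n" for l m
    unfolding mult_mat_index_sum[OF mult_carrier_mat[OF S M] mat_adjoint_carrier[OF S] that]
    by (simp add: mult_mat_index_sum[OF S M that(1)] mat_adjoint_index[OF S _ that(2)]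
        sum_distrib_right)
  have "(\<Sum>j<n. \<Sum>k<n. M $$ (j, k) * (a j * cnj (b k))) =
      (\<Sum>j<n. \<Sum>k<n. \<Sum>l<n. \<Sum>m<n.
        S $$ (l, j) * M $$ (j, k) * cnj (S $$ (m, k)) * (a' l * cnj (b' m)))"
    by (simp add: a b sum_distrib_left sum_distrib_right mult_ac)
      (intro sum.cong refl sum.swap)
  also have "\<dots> = (\<Sum>l<n. \<Sum>m<n. \<Sum>k<n. \<Sum>j<n.
        S $$ (l, j) * M $$ (j, k) * cnj (S $$ (m, k)) * (a' l * cnj (b' m)))"
    (is "?L = ?R")
  proof -
    let ?t = "\<lambda>j k l m. S $$ (l, j) * M $$ (j, k) * cnj (S $$ (m, k)) * (a' l * cnj (b' m))"
    have "?L = (\<Sum>j<n. \<Sum>l<n. \<Sum>k<n. \<Sum>m<n. ?t j k l m)"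
      by (intro sum.cong refl sum.swap)
    also have "\<dots> = (\<Sum>l<n. \<Sum>j<n. \<Sum>k<n. \<Sum>m<n. ?t j k l m)"
      by (rule sum.swap)
    also have "\<dots> = (\<Sum>l<n. \<Sum>j<n. \<Sum>m<n. \<Sum>k<n. ?t j k l m)"
      by (intro sum.cong refl sum.swap)
    also have "\<dots> = (\<Sum>l<n. \<Sum>m<n. \<Sum>j<n. \<Sum>k<n. ?t j k l m)"
      by (intro sum.cong refl sum.swap)
    also have "\<dots> = ?R"
      by (intro sum.cong refl sum.swap)
    finally show ?thesis .
  qed
  also have "\<dots> = (\<Sum>l<n. \<Sum>m<n. (S * M * mat_adjoint S) $$ (l, m) * (a' l * cnj (b' m)))"
    by (intro sum.cong refl) (simp add: entry sum_distrib_right)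
  finally show ?thesis .
qed

section \<open>Isomorphisms read off from a coframe\<close>

text \<open>The domain is an arbitrary real vector space, so surjectivity comes from comparing the given
  dimension with that of the Euclidean target.\<close>

lemma lie_isomorphicI_injective:
  fixes f :: "'a::real_vector \<Rightarrow> 'b::euclidean_space"
  assumes f: "linear f" and inj: "\<And>x. f x = 0 \<Longrightarrow> x = 0"
    and dim: "dim (UNIV :: 'a set) = DIM('b)"
    and hom: "\<And>x y. f (br x y) = br' (f x) (f y)"
  shows "lie_isomorphic br br'"
proof -
  have "inj f"
    using inj linear_injective_0[OF f] by auto
  obtain B :: "'a set" where B: "independent B" "card B = DIM('b)"
    using real_vector.basis_exists[of "UNIV :: 'a set"] dim by metis
  have "inj_on f (span B)"
    using \<open>inj f\<close> by (rule inj_on_subset) simp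
  then have "independent (f ` B)" "card (f ` B) = DIM('b)"
    using linear_independent_injective_image[OF f B(1)] card_image[of f B] B(2)
    by (auto intro: inj_on_subset[OF \<open>inj f\<close>])
  then have "span (f ` B) = UNIV"
    using card_ge_dim_independent[of "f ` B" UNIV] by auto
  then have "span (range f) = UNIV"
    by (metis image_mono span_mono subset_UNIV top.extremum_uniqueI)
  then have "surj f"
    using linear_subspace_image[OF f subspace_UNIV] by (metis real_vector.span_eq_iff)
  then show ?thesis
    unfolding lie_isomorphic_def bij_def using f \<open>inj f\<close> hom by blast
qed

lemma forall_8: "(\<forall>i::8. P i) \<longleftrightarrow> P 1 \<and> P 2 \<and> P 3 \<and> P 4 \<and> P 5 \<and> P 6 \<and> P 7 \<and> P 8"
proof -
  have "i = 1 \<or> i = 2 \<or> i = 3 \<or> i = 4 \<or> i = 5 \<or> i = 6 \<or> i = 7 \<or> i = 8" for i :: 8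
  proof (induct i)
    case (of_int z)
    then have "0 \<le> z" "z < 8"
      by simp_all
    then have "z = 0 \<or> z = 1 \<or> z = 2 \<or> z = 3 \<or> z = 4 \<or> z = 5 \<or> z = 6 \<or> z = 7"
      by arith
    then show ?case
      by auto
  qed
  then show ?thesis
    by metis
qed

text \<open>Faithfulness, that is, the absence of a nonzero common zero, replaces linear independence: when
  the real dimension is \<open>8\<close>, it says that the real and imaginary parts of the four forms are
  a basis of the dual. It also passes to a new coframe by solving linear equations pointwise.\<close>

definition closed_coframe ::
    "('a::real_vector \<Rightarrow> 'a \<Rightarrow> 'a) \<Rightarrow> ('a \<Rightarrow> complex) \<Rightarrow> ('a \<Rightarrow> complex) \<Rightarrow> ('a \<Rightarrow> complex) \<Rightarrow>
      ('a \<Rightarrow> complex) \<Rightarrow> bool" where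
  "closed_coframe br \<alpha> \<beta> \<gamma> \<tau> \<longleftrightarrow>
     linear \<alpha> \<and> linear \<beta> \<and> linear \<gamma> \<and> linear \<tau> \<and>
     (\<forall>x y. \<alpha> (br x y) = 0 \<and> \<beta> (br x y) = 0 \<and> \<gamma> (br x y) = 0) \<and>
     (\<forall>x. \<alpha> x = 0 \<longrightarrow> \<beta> x = 0 \<longrightarrow> \<gamma> x = 0 \<longrightarrow> \<tau> x = 0 \<longrightarrow> x = 0)"

lemma linear_Re_Im:
  assumes "linear f"
  shows "Re (f (x + y)) = Re (f x) + Re (f y)" "Im (f (x + y)) = Im (f x) + Im (f y)"
    "Re (f (c *\<^sub>R x)) = c * Re (f x)" "Im (f (c *\<^sub>R x)) = c * Im (f x)"
  using linear_add[OF assms] linear_scale[OF assms] by auto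

text \<open>Write \<open>\<alpha> = a + i b\<close>, \<open>\<beta> = u + i v\<close>, \<open>\<gamma> = p + i q\<close>. Then \<open>\<alpha> \<and> \<alpha>\<^sup>* = - 2 i a \<and> b\<close> and
  \<open>\<beta> \<and> \<gamma>\<^sup>* = u \<and> p + v \<and> q + i (v \<and> p - u \<and> q)\<close>. Hence the real part of \<open>d\<tau>\<close> has the shape
  \<open>e\<^sup>1\<^sup>4 - e\<^sup>2\<^sup>3\<close> and the negative of its imaginary part the shape \<open>e\<^sup>1\<^sup>3 + e\<^sup>2\<^sup>4 + e\<^sup>5\<^sup>6\<close> in the
  coframe \<open>u, -v, q, p, 2 a, b, - Im \<tau>, Re \<tau>\<close>.\<close>

lemma isomorphic_g8_r5:
  fixes br :: "'a::real_vector \<Rightarrow> 'a \<Rightarrow> 'a"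
  assumes dim: "dim (UNIV :: 'a set) = 8" and cof: "closed_coframe br \<alpha> \<beta> \<gamma> \<tau>"
    and d: "\<And>x y. ce_d br \<tau> x y = wedge \<alpha> (cnj_form \<alpha>) x y + wedge \<beta> (cnj_form \<gamma>) x y"
  shows "lie_isomorphic br g8_r5"
proof -
  define f :: "'a \<Rightarrow> real^8" where "f x = (\<chi> i.
      if i = 1 then Re (\<beta> x) else if i = 2 then - Im (\<beta> x)
      else if i = 3 then Im (\<gamma> x) else if i = 4 then Re (\<gamma> x)
      else if i = 5 then 2 * Re (\<alpha> x) else if i = 6 then Im (\<alpha> x)
      else if i = 7 then - Im (\<tau> x) else Re (\<tau> x))" for x
  have comp: "f x $ 1 = Re (\<beta> x)" "f x $ 2 = - Im (\<beta> x)" "f x $ 3 = Im (\<gamma> x)" "f x $ 4 = Re (\<gamma> x)"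
    "f x $ 5 = 2 * Re (\<alpha> x)" "f x $ 6 = Im (\<alpha> x)" "f x $ 7 = - Im (\<tau> x)" "f x $ 8 = Re (\<tau> x)" for x
    by (simp_all add: f_def)
  note lin = cof[unfolded closed_coframe_def]
  have "linear f"
    using lin by (intro linearI)
      (auto simp: f_def Finite_Cartesian_Product.vec_eq_iff linear_Re_Im algebra_simps)
  moreover have "x = 0" if "f x = 0" for x
  proof -
    have "f x $ i = 0" for i
      using that by simp
    note this[of 1] this[of 2] this[of 3] this[of 4] this[of 5] this[of 6] this[of 7] this[of 8]
    then have "\<alpha> x = 0" "\<beta> x = 0" "\<gamma> x = 0" "\<tau> x = 0"
      unfolding comp by (simp_all add: complex_eq_iff)
    then show ?thesis
      using lin by blast
  qed
  moreover have "f (br x y) = g8_r5 (f x) (f y)" for x y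
  proof -
    have "\<tau> (br x y) = - (wedge \<alpha> (cnj_form \<alpha>) x y + wedge \<beta> (cnj_form \<gamma>) x y)"
      using d[of x y] by (metis ce_d_def minus_minus)
    then have "Re (\<tau> (br x y)) = - (Re (\<beta> x) * Re (\<gamma> y) - Re (\<beta> y) * Re (\<gamma> x)
        + (Im (\<beta> x) * Im (\<gamma> y) - Im (\<beta> y) * Im (\<gamma> x)))"
      "- Im (\<tau> (br x y)) = - (2 * (Re (\<alpha> x) * Im (\<alpha> y) - Re (\<alpha> y) * Im (\<alpha> x))
        - (Im (\<beta> x) * Re (\<gamma> y) - Im (\<beta> y) * Re (\<gamma> x)) + (Re (\<beta> x) * Im (\<gamma> y) - Re (\<beta> y) * Im (\<gamma> x)))"
      unfolding \<open>\<tau> (br x y) = _\<close> by (simp_all add: wedge_def cnj_form_def algebra_simps)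
    then show ?thesis
      using lin
      by (simp add: Finite_Cartesian_Product.vec_eq_iff forall_8 g8_r5_def wedge_def coform_def comp)
  qed
  ultimately show ?thesis
    using dim by (intro lie_isomorphicI_injective[of f]) auto
qed

text \<open>With \<open>\<alpha> = a + i b\<close>, \<open>\<beta> = u + i v\<close>, \<open>\<gamma> = p + i q\<close>, collecting the factors of \<open>u\<close> and \<open>v\<close> gives
  \<open>d (Re \<tau>) = (a - p) \<and> u + (b - q) \<and> v\<close> and \<open>d (Im \<tau>) = v \<and> (a + p) - u \<and> (b + q)\<close>,
  which are the structure equations in the coframe
  \<open>a - p, b - q, u, v, a + p, -(b + q), Re \<tau>, Im \<tau>\<close>.\<close>

lemma isomorphic_g8_s1:
  fixes br :: "'a::real_vector \<Rightarrow> 'a \<Rightarrow> 'a"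
  assumes dim: "dim (UNIV :: 'a set) = 8" and cof: "closed_coframe br \<alpha> \<beta> \<gamma> \<tau>"
    and d: "\<And>x y. ce_d br \<tau> x y = wedge \<alpha> (cnj_form \<beta>) x y + wedge \<beta> (cnj_form \<gamma>) x y"
  shows "lie_isomorphic br g8_s1"
proof -
  define f :: "'a \<Rightarrow> real^8" where "f x = (\<chi> i.
      if i = 1 then Re (\<alpha> x) - Re (\<gamma> x) else if i = 2 then Im (\<alpha> x) - Im (\<gamma> x)
      else if i = 3 then Re (\<beta> x) else if i = 4 then Im (\<beta> x)
      else if i = 5 then Re (\<alpha> x) + Re (\<gamma> x) else if i = 6 then - (Im (\<alpha> x) + Im (\<gamma> x))
      else if i = 7 then Re (\<tau> x) else Im (\<tau> x))" for x
  have comp: "f x $ 1 = Re (\<alpha> x) - Re (\<gamma> x)" "f x $ 2 = Im (\<alpha> x) - Im (\<gamma> x)"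
    "f x $ 3 = Re (\<beta> x)" "f x $ 4 = Im (\<beta> x)"
    "f x $ 5 = Re (\<alpha> x) + Re (\<gamma> x)" "f x $ 6 = - (Im (\<alpha> x) + Im (\<gamma> x))"
    "f x $ 7 = Re (\<tau> x)" "f x $ 8 = Im (\<tau> x)" for x
    by (simp_all add: f_def)
  note lin = cof[unfolded closed_coframe_def]
  have "linear f"
    using lin by (intro linearI)
      (auto simp: f_def Finite_Cartesian_Product.vec_eq_iff linear_Re_Im algebra_simps)
  moreover have "x = 0" if "f x = 0" for x
  proof -
    have "f x $ i = 0" for i
      using that by simp
    note this[of 1] this[of 2] this[of 3] this[of 4] this[of 5] this[of 6] this[of 7] this[of 8]
    then have "\<alpha> x = 0" "\<beta> x = 0" "\<gamma> x = 0" "\<tau> x = 0"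
      unfolding comp by (simp_all add: complex_eq_iff)
    then show ?thesis
      using lin by blast
  qed
  moreover have "f (br x y) = g8_s1 (f x) (f y)" for x y
  proof -
    have "\<tau> (br x y) = - (wedge \<alpha> (cnj_form \<beta>) x y + wedge \<beta> (cnj_form \<gamma>) x y)"
      using d[of x y] by (metis ce_d_def minus_minus)
    then have "Re (\<tau> (br x y)) = - Re (wedge \<alpha> (cnj_form \<beta>) x y + wedge \<beta> (cnj_form \<gamma>) x y)"
      "Im (\<tau> (br x y)) = - Im (wedge \<alpha> (cnj_form \<beta>) x y + wedge \<beta> (cnj_form \<gamma>) x y)"
      by simp_all
    then show ?thesis
      using lin
      by (simp add: Finite_Cartesian_Product.vec_eq_iff forall_8 g8_s1_def wedge_def coform_def comp)
        (simp add: f_def cnj_form_def algebra_simps)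
  qed
  ultimately show ?thesis
    using dim by (intro lie_isomorphicI_injective[of f]) auto
qed

section \<open>The two normal forms of the differential\<close>

lemma linear_combination_form:
  fixes f g h :: "'a::real_vector \<Rightarrow> complex"
  assumes "linear f" "linear g" "linear h"
  shows "linear (\<lambda>x. a * f x + b * g x + c * h x)"
  using assms by (intro linearI) (auto simp: linear_add linear_scale algebra_simps)

text \<open>Together with \<open>q2 \<noteq> 0\<close>, the hypothesis \<open>indep\<close> says that \<open>\<rho>\<close> is not a multiple of \<open>\<sigma>\<close>. The
  multiple \<open>t \<sigma>\<close> is the one that removes \<open>\<gamma>\<close> from \<open>\<rho>\<close>; since \<open>\<alpha> \<and> (t \<sigma>)\<^sup>* = (cnj t \<alpha>) \<and> \<sigma>\<^sup>*\<close>, it is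
  absorbed into the partner \<open>\<beta>'\<close> of \<open>\<sigma>\<close>. What remains of \<open>\<rho>\<close> is \<open>P \<alpha> + Q \<beta>'\<close>, and \<open>\<sigma>\<close> takes the place
  of \<open>\<gamma>\<close> in the coframe.\<close>

lemma isomorphic_of_rank_two_differential:
  fixes br :: "'a::real_vector \<Rightarrow> 'a \<Rightarrow> 'a"
  assumes dim: "dim (UNIV :: 'a set) = 8" and cof: "closed_coframe br \<alpha> \<beta> \<gamma> \<tau>"
    and \<rho>: "\<And>x. \<rho> x = p0 * \<alpha> x + p1 * \<beta> x + p2 * \<gamma> x"
    and \<sigma>: "\<And>x. \<sigma> x = q0 * \<alpha> x + q1 * \<beta> x + q2 * \<gamma> x"
    and q2: "q2 \<noteq> 0"
    and indep: "\<not> (p0 * q2 = p2 * q0 \<and> p1 * q2 = p2 * q1)"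
    and d: "\<And>x y. ce_d br \<tau> x y = wedge \<alpha> (cnj_form \<rho>) x y + wedge \<beta> (cnj_form \<sigma>) x y"
  shows "lie_isomorphic br g8_s1 \<or> lie_isomorphic br g8_r5"
proof -
  define t where "t = p2 / q2"
  define \<beta>' where "\<beta>' x = \<beta> x + cnj t * \<alpha> x" for x
  define P where "P = (p0 - t * q0) - (p1 - t * q1) * cnj t"
  define Q where "Q = p1 - t * q1"
  have \<rho>': "\<rho> x = t * \<sigma> x + P * \<alpha> x + Q * \<beta>' x" for x
    unfolding \<rho> \<sigma> \<beta>'_def P_def Q_def using q2 by (simp add: t_def field_simps)
  have d': "- \<tau> (br x y) = wedge \<alpha> (cnj_form (\<lambda>x. P * \<alpha> x + Q * \<beta>' x)) x y + wedge \<beta>' (cnj_form \<sigma>) x y"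
    for x y
    using d[of x y] by (simp add: ce_d_def wedge_def cnj_form_def \<rho>' \<beta>'_def algebra_simps)
  have lin: "linear \<alpha>" "linear \<beta>" "linear \<gamma>" "linear \<tau>"
    and closed: "\<alpha> (br x y) = 0" "\<beta> (br x y) = 0" "\<gamma> (br x y) = 0"
    and faith: "\<alpha> x = 0 \<Longrightarrow> \<beta> x = 0 \<Longrightarrow> \<gamma> x = 0 \<Longrightarrow> \<tau> x = 0 \<Longrightarrow> x = 0" for x y
    using cof by (auto simp: closed_coframe_def)
  note lc = linear_combination_form[OF lin(1-3)]
  have \<beta>'_closed: "\<beta>' (br x y) = 0" and \<sigma>_closed: "\<sigma> (br x y) = 0" for x y
    by (simp_all add: \<beta>'_def \<sigma> closed)
  have \<beta>'_lin: "linear \<beta>'"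
    using lc[of "cnj t" 1 0] by (simp add: \<beta>'_def[abs_def] add.commute)
  have \<sigma>_lin: "linear \<sigma>"
    using lc[of q0 q1 q2] by (simp add: \<sigma>[abs_def])
  have faith': "x = 0" if "\<alpha> x = 0" "\<beta>' x = 0" "\<sigma> x = 0" "\<tau> x = 0" for x
    using that q2 faith[of x] by (auto simp: \<beta>'_def \<sigma>)
  show ?thesis
  proof (cases "P = 0")
    case True
    have "Q \<noteq> 0"
    proof
      assume "Q = 0"
      then have "p1 = t * q1" "p0 = t * q0"
        using True by (auto simp: P_def Q_def)
      then show False
        using indep q2 by (simp add: t_def)
    qed
    have "closed_coframe br (\<lambda>x. cnj Q * \<alpha> x) \<beta>' \<sigma> \<tau>"
      unfolding closed_coframe_def
      using lc[of "cnj Q" 0 0] \<beta>'_lin \<sigma>_lin lin(4) \<beta>'_closed \<sigma>_closed closed faith' \<open>Q \<noteq> 0\<close>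
      by auto
    then have "lie_isomorphic br g8_s1"
    proof (rule isomorphic_g8_s1[OF dim])
      show "ce_d br \<tau> x y = wedge (\<lambda>x. cnj Q * \<alpha> x) (cnj_form \<beta>') x y + wedge \<beta>' (cnj_form \<sigma>) x y" for x y
        using d'[of x y] True by (simp add: ce_d_def wedge_def cnj_form_def algebra_simps)
    qed
    then show ?thesis ..
  next
    case False
    \<comment> \<open>Completing the square: after division by \<open>cnj P\<close> the first term is \<open>\<alpha> \<and> \<alpha>'\<^sup>*\<close>, and replacing
      its left factor by \<open>\<alpha>'\<close> costs \<open>- c \<beta>' \<and> \<alpha>'\<^sup>*\<close>, which \<open>\<gamma>'\<close> absorbs.\<close>
    define c where "c = Q / P"
    define \<alpha>' where "\<alpha>' x = \<alpha> x + c * \<beta>' x" for x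
    define \<gamma>' where "\<gamma>' x = 1 / P * \<sigma> x - cnj c * \<alpha>' x" for x
    define \<tau>' where "\<tau>' x = 1 / cnj P * \<tau> x" for x
    have "linear \<alpha>'"
      using linear_combination_form[OF lin(1) \<beta>'_lin \<sigma>_lin, of 1 c 0] by (simp add: \<alpha>'_def[abs_def])
    moreover from this have "linear \<gamma>'"
      using linear_combination_form[OF _ \<beta>'_lin \<sigma>_lin, of \<alpha>' "- cnj c" 0 "1 / P"]
      by (simp add: \<gamma>'_def[abs_def])
    moreover have "linear \<tau>'"
      using linear_combination_form[OF lin(4) lin(4) lin(4), of "1 / cnj P" 0 0]
      by (simp add: \<tau>'_def[abs_def])
    moreover have "x = 0" if "\<alpha>' x = 0" "\<beta>' x = 0" "\<gamma>' x = 0" "\<tau>' x = 0" for x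
      using that faith'[of x] False by (auto simp: \<alpha>'_def \<gamma>'_def \<tau>'_def)
    ultimately have "closed_coframe br \<alpha>' \<beta>' \<gamma>' \<tau>'"
      unfolding closed_coframe_def using \<beta>'_lin \<beta>'_closed \<sigma>_closed closed
      by (auto simp: \<alpha>'_def \<gamma>'_def)
    then have "lie_isomorphic br g8_r5"
    proof (rule isomorphic_g8_r5[OF dim])
      fix x y
      have "P * c = Q"
        using False by (simp add: c_def)
      have "cnj P * (wedge \<alpha>' (cnj_form \<alpha>') x y + wedge \<beta>' (cnj_form \<gamma>') x y) =
        wedge \<alpha> (cnj_form (\<lambda>x. P * \<alpha> x + Q * \<beta>' x)) x y + wedge \<beta>' (cnj_form \<sigma>) x y"
        unfolding \<open>P * c = Q\<close>[symmetric] using False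
        by (simp add: wedge_def cnj_form_def \<gamma>'_def) (simp add: \<alpha>'_def field_simps)
      then show "ce_d br \<tau>' x y = wedge \<alpha>' (cnj_form \<alpha>') x y + wedge \<beta>' (cnj_form \<gamma>') x y"
        using d'[of x y] False by (simp add: ce_d_def \<tau>'_def field_simps)
    qed
    then show ?thesis ..
  qed
qed

section \<open>The classification\<close>

text \<open>A real functional \<open>g\<close> with \<open>g x \<noteq> 0\<close> is the real part of a form of type (1,0), namely
  \<open>g - i (g \<circ> J)\<close>.\<close>

lemma forms10_separate_points:
  fixes J :: "'a::real_vector \<Rightarrow> 'a"
  assumes J: "linear J" "\<And>x. J (J x) = - x" and x: "\<And>\<alpha>. \<alpha> \<in> forms10 J \<Longrightarrow> \<alpha> x = 0"
  shows "x = 0"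
proof (rule ccontr)
  assume "x \<noteq> 0"
  then have "independent {x}"
    by simp
  then obtain g :: "'a \<Rightarrow> real" where g: "linear g" "g x = 1"
    using linear_independent_extend[of "{x}" "\<lambda>_. 1 :: real"] by auto
  define \<alpha> where "\<alpha> y = Complex (g y) (- g (J y))" for y
  have "\<alpha> \<in> forms10 J"
    using g(1) J
    by (auto simp: forms10_def \<alpha>_def complex_eq_iff linear_add linear_scale linear_neg intro!: linearI)
  then show False
    using x[of \<alpha>] g(2) by (simp add: \<alpha>_def complex_eq_iff)
qed

theorem theorem4p25:
  fixes br :: "'a::real_vector \<Rightarrow> 'a \<Rightarrow> 'a"
    and J :: "'a \<Rightarrow> 'a"
    and \<omega> :: "nat \<Rightarrow> 'a \<Rightarrow> complex"
    and M :: "complex mat"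
  assumes "lie_algebra br" and "dim (UNIV :: 'a set) = 8" and "nilpotent_lie br"
    and "one_abelian br J 4"
    and "M \<in> carrier_mat 3 3" and "\<not> invertible_mat M" and "mat_adjoint M \<noteq> M"
    and "defined_by_matrix br J 4 \<omega> M"
    and "maximal_type M"
  shows "lie_isomorphic br g8_s1 \<or> lie_isomorphic br g8_r5"
proof -
  note M = \<open>M \<in> carrier_mat 3 3\<close>
  have J: "linear J" "\<And>x. J (J x) = - x"
    using \<open>one_abelian br J 4\<close>
    by (auto simp: one_abelian_def abelian_complex_structure_def complex_structure_def)
  have span: "cform.span (\<omega> ` {..<4}) = forms10 J"
    and closed: "\<And>i x y. i < 3 \<Longrightarrow> \<omega> i (br x y) = 0"
    and d: "\<And>x y. - \<omega> 3 (br x y) = (\<Sum>j<3. \<Sum>k<3. M $$ (j, k) * wedge (\<omega> j) (cnj_form (\<omega> k)) x y)"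
    using \<open>defined_by_matrix br J 4 \<omega> M\<close> by (auto simp: defined_by_matrix_def ce_d_def fun_eq_iff)
  have lin: "linear (\<omega> i)" if "i < 4" for i
    using that span cform.span_base[of "\<omega> i" "\<omega> ` {..<4}"] by (auto simp: forms10_def)
  have faith: "x = 0" if "\<And>i. i < 4 \<Longrightarrow> \<omega> i x = 0" for x
  proof (rule forms10_separate_points[OF J])
    fix \<alpha> assume "\<alpha> \<in> forms10 J"
    then have "\<alpha> \<in> cform.span (\<omega> ` {..<4})"
      using span by simp
    then show "\<alpha> x = 0"
      by (induction rule: cform.span_induct_alt) (use that in auto)
  qed
  obtain S P where S: "S \<in> carrier_mat 3 3" and P: "P \<in> carrier_mat 3 3"
    and SP: "S * P = 1\<^sub>m 3" "P * S = 1\<^sub>m 3"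
    and rank: "vec_space.rank 3 M = 2"
    and row2: "\<And>c. c < 3 \<Longrightarrow> (S * M * mat_adjoint S) $$ (2, c) = 0"
    and col2: "(S * M * mat_adjoint S) $$ (0, 2) \<noteq> 0 \<or> (S * M * mat_adjoint S) $$ (1, 2) \<noteq> 0"
    using maximal_type_singular_3[OF M \<open>\<not> invertible_mat M\<close> \<open>maximal_type M\<close>] by blast
  define A where "A = S * M * mat_adjoint S"
  have A: "A \<in> carrier_mat 3 3"
    using S M mat_adjoint_carrier[OF S] by (auto simp: A_def)
  \<comment> \<open>\<open>\<eta> = P\<^sup>T \<omega>\<close> is the coframe in which \<open>d\<omega>\<^sub>3\<close> has matrix \<open>A\<close>, because \<open>\<omega> = S\<^sup>T \<eta>\<close>.\<close>
  define \<eta> where "\<eta> l x = (\<Sum>j<3. P $$ (j, l) * \<omega> j x)" for l x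
  have \<omega>: "\<omega> j x = (\<Sum>l<3. S $$ (l, j) * \<eta> l x)" if "j < 3" for j x
  proof -
    have "(\<Sum>l<3. S $$ (l, j) * \<eta> l x) = (\<Sum>i<3. (P * S) $$ (i, j) * \<omega> i x)"
      unfolding \<eta>_def sum_distrib_left
      by (subst sum.swap) (simp add: mult_mat_index_sum[OF P S _ that] sum_distrib_right, simp add: mult_ac)
    also have "\<dots> = (\<Sum>i<3. if i = j then \<omega> i x else 0)"
      unfolding SP using that by (intro sum.cong) auto
    finally show ?thesis
      using that by simp
  qed
  have d\<eta>: "- \<omega> 3 (br x y) = (\<Sum>l<3. \<Sum>m<3. A $$ (l, m) * wedge (\<eta> l) (cnj_form (\<eta> m)) x y)" for x y
  proof -
    have "- \<omega> 3 (br x y) = (\<Sum>j<3. \<Sum>k<3. M $$ (j, k) * (\<omega> j x * cnj (\<omega> k y)))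
        - (\<Sum>j<3. \<Sum>k<3. M $$ (j, k) * (\<omega> j y * cnj (\<omega> k x)))"
      by (simp add: d wedge_def cnj_form_def algebra_simps sum_subtractf)
    also have "\<dots> = (\<Sum>l<3. \<Sum>m<3. A $$ (l, m) * (\<eta> l x * cnj (\<eta> m y)))
        - (\<Sum>l<3. \<Sum>m<3. A $$ (l, m) * (\<eta> l y * cnj (\<eta> m x)))"
      unfolding A_def
      by (intro arg_cong2[where f = "(-)"] sesquilinear_base_change[OF S M] \<omega>)
    finally show ?thesis
      by (simp add: wedge_def cnj_form_def algebra_simps sum_subtractf)
  qed
  have lt3: "{..<3} = {0, 1, 2 :: nat}"
    by auto
  have \<eta>_lin: "linear (\<eta> l)" for l
    using linear_combination_form[OF lin[of 0] lin[of 1] lin[of 2], of "P $$ (0, l)" "P $$ (1, l)" "P $$ (2, l)"]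
    by (simp add: \<eta>_def[abs_def] lt3 add.assoc)
  have \<eta>_closed: "\<eta> l (br x y) = 0" for l x y
    by (simp add: \<eta>_def closed)
  have faith\<eta>: "x = 0" if "\<eta> 0 x = 0" "\<eta> 1 x = 0" "\<eta> 2 x = 0" "\<omega> 3 x = 0" for x
  proof (rule faith)
    fix i :: nat assume "i < 4"
    then have "i < 3 \<or> i = 3"
      by auto
    then show "\<omega> i x = 0"
      using that \<omega>[of i x] by (auto simp: lt3)
  qed
  have cof: "closed_coframe br (\<eta> 0) (\<eta> 1) (\<eta> 2) (\<omega> 3)" "closed_coframe br (\<eta> 1) (\<eta> 0) (\<eta> 2) (\<omega> 3)"
    unfolding closed_coframe_def using \<eta>_lin \<eta>_closed lin[of 3] faith\<eta> by auto
  \<comment> \<open>Otherwise \<open>M\<close>, which is \<open>A\<close> up to invertible factors, would have rank at most \<open>1\<close>.\<close>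
  have not_outer: "\<not> (\<forall>r<3. \<forall>c<3. A $$ (r, c) = f r * g c)" for f g :: "nat \<Rightarrow> complex"
  proof
    assume *: "\<forall>r<3. \<forall>c<3. A $$ (r, c) = f r * g c"
    have adj: "mat_adjoint S * mat_adjoint P = 1\<^sub>m 3"
      using mat_adjoint_mult[OF P S] SP by (simp add: mat_adjoint_one)
    note cS = mat_adjoint_carrier[OF S] and cP = mat_adjoint_carrier[OF P]
    have "P * A * mat_adjoint P = P * (S * (M * (mat_adjoint S * mat_adjoint P)))"
      unfolding A_def using S M P cS cP by (simp add: assoc_mult_mat[of _ 3 3 _ 3 _ 3])
    also have "\<dots> = P * S * M"
      using S M P adj by (simp add: assoc_mult_mat[of _ 3 3 _ 3 _ 3])
    also have "\<dots> = M"
      using M SP by simp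
    finally have "vec_space.rank 3 M \<le> 1"
      using rank_le_1_mult_product_entries[OF P A cP, of f g] * by simp
    then show False
      using rank by simp
  qed
  \<comment> \<open>The last row of \<open>A\<close> vanishes, so only \<open>\<eta>\<^sub>0\<close> and \<open>\<eta>\<^sub>1\<close> occur as left factors.\<close>
  let ?row = "\<lambda>l x. cnj (A $$ (l, 0)) * \<eta> 0 x + cnj (A $$ (l, 1)) * \<eta> 1 x + cnj (A $$ (l, 2)) * \<eta> 2 x"
  have d2: "ce_d br (\<omega> 3) x y = wedge (\<eta> 0) (cnj_form (?row 0)) x y + wedge (\<eta> 1) (cnj_form (?row 1)) x y"
    for x y
    unfolding ce_d_def d\<eta> using row2 by (simp add: lt3 A_def[symmetric] wedge_def cnj_form_def algebra_simps)
  \<comment> \<open>If row \<open>k\<close> were a multiple of row \<open>l\<close>, then \<open>A\<close> would be an outer product.\<close>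
  have indep: "\<not> (A $$ (k, 0) * A $$ (l, 2) = A $$ (k, 2) * A $$ (l, 0) \<and>
      A $$ (k, 1) * A $$ (l, 2) = A $$ (k, 2) * A $$ (l, 1))"
    if kl: "k = 0 \<and> l = 1 \<or> k = 1 \<and> l = 0" and nz: "A $$ (l, 2) \<noteq> 0" for k l
  proof
    assume *: "A $$ (k, 0) * A $$ (l, 2) = A $$ (k, 2) * A $$ (l, 0) \<and>
      A $$ (k, 1) * A $$ (l, 2) = A $$ (k, 2) * A $$ (l, 1)"
    have "A $$ (r, c) = (if r = k then A $$ (k, 2) / A $$ (l, 2) else if r = l then 1 else 0) * A $$ (l, c)"
      if "r < 3" "c < 3" for r c
    proof -
      have "c \<in> {0, 1, 2}" "r \<in> {k, l, 2}"
        using that kl by auto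
      then show ?thesis
        using * nz kl row2[of c] that by (auto simp: A_def[symmetric] field_simps)
    qed
    then show False
      using not_outer[of "\<lambda>r. if r = k then A $$ (k, 2) / A $$ (l, 2) else if r = l then 1 else 0"
          "\<lambda>c. A $$ (l, c)"] by blast
  qed
  show ?thesis
  proof (cases "A $$ (1, 2) = 0")
    case False
    show ?thesis
    proof (rule isomorphic_of_rank_two_differential[OF \<open>dim UNIV = 8\<close> cof(1)])
      show "\<not> (cnj (A $$ (0, 0)) * cnj (A $$ (1, 2)) = cnj (A $$ (0, 2)) * cnj (A $$ (1, 0)) \<and>
          cnj (A $$ (0, 1)) * cnj (A $$ (1, 2)) = cnj (A $$ (0, 2)) * cnj (A $$ (1, 1)))"
        using indep[of 0 1] False by (simp flip: complex_cnj_mult)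
    qed (use d2 False in auto)
  next
    case True
    then have nz: "A $$ (0, 2) \<noteq> 0"
      using col2 by (simp add: A_def)
    show ?thesis
    proof (rule isomorphic_of_rank_two_differential[OF \<open>dim UNIV = 8\<close> cof(2)])
      show "\<not> (cnj (A $$ (1, 1)) * cnj (A $$ (0, 2)) = cnj (A $$ (1, 2)) * cnj (A $$ (0, 1)) \<and>
          cnj (A $$ (1, 0)) * cnj (A $$ (0, 2)) = cnj (A $$ (1, 2)) * cnj (A $$ (0, 0)))"
        using indep[of 1 0] nz by (auto simp flip: complex_cnj_mult)
      show "ce_d br (\<omega> 3) x y = wedge (\<eta> 1) (cnj_form (?row 1)) x y + wedge (\<eta> 0) (cnj_form (?row 0)) x y"
        for x y
        using d2[of x y] by (simp add: add.commute)
    qed (use nz in auto)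
  qed
qed

end
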